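(* Assume that $g_2$ is continuously differentiable with $L_{g_2}$-Lipschitz continuous gradient (while $g_1$ is a proper lower semicontinuous convex function). Let $\{x^n\}_n$ be the bounded sequence generated by Algorithm pABBDCA$_{\mathrm{er}}$ (described in the context) for minimizing $E=f+g_1-g_2$. Suppose $E$ is a KL function with exponent $\theta\in[0,1)$. Then the sequence $\{x^n\}_n$ globally converges to a critical point $x^*$ with a finite trajectory length, i.e. $$\sum_{n=0}^{\infty}\|x^{n+1}-x^n\|<\infty.$$
   Context: Setting. $X$ is a finite-dimensional real Hilbert space with inner product $\langle\cdot,\cdot\rangle$ and norm $\|\cdot\|$. $E(x)=f(x)+g_1(x)-g_2(x)$, where $f$ is convex and continuously differentiable with $L$-Lipschitz gradient, and $g_1,g_2$ are proper closed convex functions. For a convex function, $\partial$ is the convex subdifferential. Standing assumptions: $E$ is bounded from below and all level sets $\{x:E(x)\le\alpha\}$, $\alpha\in\mathbb{R}$, are compact. When $g_2$ is differentiable, $\partial E(x)=\nabla f(x)+\partial g_1(x)-\nabla g_2(x)$; $x$ is a critical point if $0\in\partial E(x)$. $\mathrm{dist}(0,S)=\inf_{s\in S}\|s\|$ ($+\infty$ if $S=\emptyset$). KL exponent. $E$ is a KL function with exponent $\theta\in[0,1)$ if at every critical point $\bar x$ there exist $\bar c,\epsilon>0$ and $\nu\in(0,+\infty]$ such that $\mathrm{dist}(0,\partial E(x))\ge\bar c\,(E(x)-E(\bar x))^{\theta}$ whenever $\|x-\bar x\|\le\epsilon$ and $E(\bar x)<E(x)<E(\bar x)+\nu$ (equivalently,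 the KL inequality $\psi'(E(x)-E(\bar x))\,\mathrm{dist}(0,\partial E(x))\ge1$ holds there with $\psi(s)=cs^{1-\theta}$, $c>0$). Algorithm pABBDCA$_{\mathrm{er}}$. Inputs: $x^0\in X$, $\alpha_0>0$, $0<\alpha_{\min}<\alpha_{\max}$, initial trial step $\lambda_0=1$, $\rho,\overline\beta,\omega\in(0,1)$, $0<\eta<1/\alpha_{\max}$, integer $N_{\max}\ge1$; $x^{-1}=x^0$. For $n=0,1,2,\dots$: 1. Set $\beta_n=\min\{\frac{n-1}{n+2},\overline\beta\}$ and $y^n=x^n+\beta_n(x^n-x^{n-1})$. Choose $\xi^n\in\partial g_2(x^n)$ and set $u^n=\arg\min_x\{\langle-\xi^n,x-y^n\rangle+\frac{1}{2\alpha_n}\|x-y^n\|^2+f(x)+g_1(x)\}$. 2. Set $d^n=u^n-x^n$, $\nu_n=\frac{\omega}{n+1}\|d^n\|^2$. If $d^n=0$, stop. 3. (Line search and restart) Find the smallest integer $k\ge0$ such that $\lambda_n=\lambda_0\rho^k$ (here $\lambda_0=1$ is the initial trial step) satisfies $E(x^n+\lambda_nd^n)\le E(x^n)-\eta\lambda_n\|d^n\|^2+\nu_n$. If $k>N_{\max}$ and $\beta_n>0$, restart: set $\beta_n=0$, $y^n=x^n$, recompute $u^n,d^n,\nu_n$ with these values, and repeat the line search. 4. Set $x^{n+1}=x^n+\lambda_nd^n$, $s^n=x^{n+1}-y^n$, $y_{bb}^n=\nabla f(x^{n+1})-\nabla f(y^n)$. 5. If $\langle s^n,y_{bb}^n\rangle>0$,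 set $\alpha_{n+1}=\max\{\alpha_{\min},\min\{\alpha_{\max},\tau_n\}\}$ with $\tau_n=\langle s^n,s^n\rangle/\langle s^n,y_{bb}^n\rangle$ for $n$ even and $\tau_n=\langle s^n,y_{bb}^n\rangle/\langle y_{bb}^n,y_{bb}^n\rangle$ for $n$ odd; otherwise $\alpha_{n+1}=\alpha_{\max}$. The sequences considered are infinite (no stopping rule other than $d^n=0$, and the algorithm does not stop). *)

theory Defs
  imports "HOL-Analysis.Analysis"
begin

section \<open>Extended-real-valued convex functions\<close>

definition proper_fun :: "('a \<Rightarrow> ereal) \<Rightarrow> bool" where
  "proper_fun g \<longleftrightarrow> (\<forall>x. g x \<noteq> - \<infinity>) \<and> (\<exists>x. g x \<noteq> \<infinity>)"

definition lsc_fun :: "('a::topological_space \<Rightarrow> ereal) \<Rightarrow> bool" where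
  "lsc_fun g \<longleftrightarrow> (\<forall>x. g x \<le> Liminf (at x) g)"

text \<open>Intended for functions that never take the value \<open>- \<infinity>\<close>, so that the right-hand side is
  never of the form \<open>\<infinity> - \<infinity>\<close>.\<close>

definition convex_ereal_fun :: "('a::real_vector \<Rightarrow> ereal) \<Rightarrow> bool" where
  "convex_ereal_fun g \<longleftrightarrow>
     (\<forall>x y. \<forall>t::real. 0 < t \<and> t < 1 \<longrightarrow>
        g ((1 - t) *\<^sub>R x + t *\<^sub>R y) \<le> ereal (1 - t) * g x + ereal t * g y)"

text \<open>The convex subdifferential; it is empty outside the effective domain.\<close>

definition subdifferential :: "('a::real_inner \<Rightarrow> ereal) \<Rightarrow> 'a \<Rightarrow> 'a set" where
  "subdifferential g x =
     {v. \<bar>g x\<bar> \<noteq> \<infinity> \<and> (\<forall>z. g x + ereal (inner v (z - x)) \<le> g z)}"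

definition grad :: "('a::real_inner \<Rightarrow> real) \<Rightarrow> 'a \<Rightarrow> 'a" where
  "grad f x = (THE D. GDERIV f x :> D)"

lemma grad_eqI:
  assumes "GDERIV f x :> D"
  shows "grad f x = D"
  unfolding grad_def
proof (rule the_equality)
  show "GDERIV f x :> D" by (rule assms)
next
  fix D'
  assume "GDERIV f x :> D'"
  then have "(\<lambda>h. inner h D') = (\<lambda>h. inner h D)"
    using assms unfolding gderiv_def by (rule has_derivative_unique)
  then have "inner h (D' - D) = 0" for h
    by (metis inner_diff_right cancel_comm_monoid_add_class.diff_cancel)
  then show "D' = D"
    by (metis inner_eq_zero_iff right_minus_eq)
qed

text \<open>Unlike \<open>infdist\<close> and \<open>setdist\<close>, this is \<open>\<infinity>\<close> for the empty set.\<close>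

definition dist0 :: "'a::real_normed_vector set \<Rightarrow> ereal" where
  "dist0 S = (INF s\<in>S. ereal (norm s))"


section \<open>The objective, critical points and the KL exponent\<close>

definition objective ::
  "('a \<Rightarrow> real) \<Rightarrow> ('a \<Rightarrow> ereal) \<Rightarrow> ('a \<Rightarrow> real) \<Rightarrow> 'a \<Rightarrow> ereal" where
  "objective f g1 g2 x = ereal (f x) + g1 x - ereal (g2 x)"

definition objective_subdiff ::
  "('a::real_inner \<Rightarrow> real) \<Rightarrow> ('a \<Rightarrow> ereal) \<Rightarrow> ('a \<Rightarrow> real) \<Rightarrow> 'a \<Rightarrow> 'a set" where
  "objective_subdiff f g1 g2 x =
     {grad f x + v - grad g2 x | v. v \<in> subdifferential g1 x}"

definition critical_point ::
  "('a::real_inner \<Rightarrow> real) \<Rightarrow> ('a \<Rightarrow> ereal) \<Rightarrow> ('a \<Rightarrow> real) \<Rightarrow> 'a \<Rightarrow> bool" where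
  "critical_point f g1 g2 x \<longleftrightarrow> 0 \<in> objective_subdiff f g1 g2 x"

text \<open>At a critical point the objective is finite, and the inequalities in the premise force
  \<open>objective f g1 g2 x\<close> to be finite as well, so \<open>real_of_ereal\<close> and \<open>powr\<close> are only applied to a
  finite positive difference. The bound \<open>\<nu>\<close> on the gap may be \<open>\<infinity>\<close>.\<close>

definition KL_exponent ::
  "('a::real_inner \<Rightarrow> real) \<Rightarrow> ('a \<Rightarrow> ereal) \<Rightarrow> ('a \<Rightarrow> real) \<Rightarrow> real \<Rightarrow> bool" where
  "KL_exponent f g1 g2 \<theta> \<longleftrightarrow>
     (\<forall>xb. critical_point f g1 g2 xb \<longrightarrow>
        (\<exists>c>0. \<exists>\<epsilon>>0. \<exists>\<nu>::ereal. 0 < \<nu> \<and>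
           (\<forall>x. norm (x - xb) \<le> \<epsilon> \<and>
                 objective f g1 g2 xb < objective f g1 g2 x \<and>
                 objective f g1 g2 x < objective f g1 g2 xb + \<nu> \<longrightarrow>
              ereal (c * real_of_ereal (objective f g1 g2 x - objective f g1 g2 xb) powr \<theta>)
                \<le> dist0 (objective_subdiff f g1 g2 x))))"


section \<open>The algorithm\<close>

definition subproblem ::
  "('a::real_inner \<Rightarrow> real) \<Rightarrow> ('a \<Rightarrow> ereal) \<Rightarrow> 'a \<Rightarrow> real \<Rightarrow> 'a \<Rightarrow> 'a \<Rightarrow> ereal" where
  "subproblem f g1 \<xi> \<alpha> y =
     (\<lambda>z. ereal (inner (- \<xi>) (z - y) + 1 / (2 * \<alpha>) * (norm (z - y))\<^sup>2 + f z) + g1 z)"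

definition armijo ::
  "('a::real_normed_vector \<Rightarrow> ereal) \<Rightarrow> real \<Rightarrow> 'a \<Rightarrow> 'a \<Rightarrow> real \<Rightarrow> real \<Rightarrow> bool" where
  "armijo E \<eta> x d \<nu> t \<longleftrightarrow> E (x + t *\<^sub>R d) \<le> E x - ereal (\<eta> * t * (norm d)\<^sup>2) + ereal \<nu>"

text \<open>One pass through the subproblem and the line search from the base point \<open>y\<close>: \<open>u\<close> solves the
  subproblem and \<open>k\<close> is the smallest exponent for which the step \<open>\<rho> ^ k\<close> (the initial trial step
  is 1) is accepted.\<close>

definition dca_pass ::
  "('a::real_inner \<Rightarrow> real) \<Rightarrow> ('a \<Rightarrow> ereal) \<Rightarrow> ('a \<Rightarrow> real) \<Rightarrow> real \<Rightarrow> real \<Rightarrow> real \<Rightarrow>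
   nat \<Rightarrow> 'a \<Rightarrow> 'a \<Rightarrow> real \<Rightarrow> 'a \<Rightarrow> 'a \<Rightarrow> nat \<Rightarrow> bool" where
  "dca_pass f g1 g2 \<rho> \<omega> \<eta> n x \<xi> \<alpha> y u k \<longleftrightarrow>
     is_arg_min (subproblem f g1 \<xi> \<alpha> y) (\<lambda>_. True) u \<and>
     (let d = u - x;
          \<nu> = \<omega> / (real n + 1) * (norm d)\<^sup>2;
          ok = (\<lambda>j. armijo (objective f g1 g2) \<eta> x d \<nu> (\<rho> ^ j))
      in ok k \<and> (\<forall>j<k. \<not> ok j))"

text \<open>Iteration \<open>n\<close>, starting from \<open>xp\<close> (previous iterate), \<open>x\<close> (current iterate) and \<open>\<alpha>\<close>, and
  producing \<open>x'\<close>. The point \<open>y\<close> is the base point actually used, i.e. \<open>x\<close> if the iteration is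
  restarted. The condition \<open>u \<noteq> x\<close> says that the stopping test \<open>d = 0\<close> fails. Since \<open>\<beta> = 0\<close>
  after a restart, there is at most one restart per iteration.\<close>

definition pABBDCA_iter ::
  "('a::real_inner \<Rightarrow> real) \<Rightarrow> ('a \<Rightarrow> ereal) \<Rightarrow> ('a \<Rightarrow> real) \<Rightarrow> real \<Rightarrow> real \<Rightarrow> real \<Rightarrow> real \<Rightarrow>
   nat \<Rightarrow> nat \<Rightarrow> 'a \<Rightarrow> 'a \<Rightarrow> 'a \<Rightarrow> real \<Rightarrow> 'a \<Rightarrow> 'a \<Rightarrow> bool" where
  "pABBDCA_iter f g1 g2 \<rho> \<beta>bar \<omega> \<eta> Nmax n xp x \<xi> \<alpha> y x' \<longleftrightarrow>
     \<xi> \<in> subdifferential (\<lambda>z. ereal (g2 z)) x \<and>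
     (let \<beta> = min ((real n - 1) / (real n + 2)) \<beta>bar;
          y0 = x + \<beta> *\<^sub>R (x - xp)
      in \<exists>u k. dca_pass f g1 g2 \<rho> \<omega> \<eta> n x \<xi> \<alpha> y0 u k \<and> u \<noteq> x \<and>
           (if k > Nmax \<and> \<beta> > 0
            then y = x \<and>
                 (\<exists>u' k'. dca_pass f g1 g2 \<rho> \<omega> \<eta> n x \<xi> \<alpha> x u' k' \<and> x' = x + \<rho> ^ k' *\<^sub>R (u' - x))
            else y = y0 \<and> x' = x + \<rho> ^ k *\<^sub>R (u - x)))"

definition bb_step :: "('a::real_inner \<Rightarrow> real) \<Rightarrow> real \<Rightarrow> real \<Rightarrow> nat \<Rightarrow> 'a \<Rightarrow> 'a \<Rightarrow> real" where
  "bb_step f \<alpha>min \<alpha>max n y x' =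
     (let s = x' - y;
          w = grad f x' - grad f y;
          \<tau> = (if even n then inner s s / inner s w else inner s w / inner w w)
      in if inner s w > 0 then max \<alpha>min (min \<alpha>max \<tau>) else \<alpha>max)"

text \<open>\<open>x\<close> is an infinite sequence of iterates. On natural numbers \<open>0 - 1 = 0\<close>, so \<open>x (n - 1)\<close>
  encodes the convention that the iterate with index \<open>-1\<close> equals \<open>x 0\<close>.\<close>

definition pABBDCA_er ::
  "('a::real_inner \<Rightarrow> real) \<Rightarrow> ('a \<Rightarrow> ereal) \<Rightarrow> ('a \<Rightarrow> real) \<Rightarrow> real \<Rightarrow> real \<Rightarrow> real \<Rightarrow>
   real \<Rightarrow> real \<Rightarrow> real \<Rightarrow> real \<Rightarrow> nat \<Rightarrow> (nat \<Rightarrow> 'a) \<Rightarrow> bool" where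
  "pABBDCA_er f g1 g2 \<alpha>0 \<alpha>min \<alpha>max \<rho> \<beta>bar \<omega> \<eta> Nmax x \<longleftrightarrow>
     (\<exists>\<xi> \<alpha> y. \<alpha> 0 = \<alpha>0 \<and>
        (\<forall>n. pABBDCA_iter f g1 g2 \<rho> \<beta>bar \<omega> \<eta> Nmax n (x (n - 1)) (x n) (\<xi> n) (\<alpha> n) (y n) (x (Suc n)) \<and>
             \<alpha> (Suc n) = bb_step f \<alpha>min \<alpha>max n (y n) (x (Suc n))))"

end

theory Submission
  imports Defs
begin

text \<open>
  From iteration 2 on, every accepted step length is at least \<open>\<rho> ^ Nmax\<close>: a shorter one triggers a
  restart, and a restarted pass accepts the full step because \<open>\<eta> < 1 / \<alpha>max\<close>
  (\<open>unextrapolated_pass_full_step\<close>). The relaxation \<open>\<omega> / (n + 1)\<close> in the line search is therefore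
  eventually at most half of the guaranteed decrease, and with \<open>d n = norm (u n - x n)\<close> the
  energies satisfy \<open>E (x (n + 1)) \<le> E (x n) - c * (d n)\<^sup>2\<close> (\<open>iteration_step\<close>). They decrease to a
  limit \<open>Es\<close>; write \<open>r n = E (x n) - Es\<close>.

  Subgradients are only available at the subproblem solutions \<open>u n\<close>, not at the iterates: the
  optimality condition gives \<open>w n\<close> in the subdifferential of \<open>E\<close> at \<open>u n\<close> with
  \<open>norm (w n) \<le> K * (d n + d (n - 1))\<close>. Thus the KL inequality has to be used at \<open>u n\<close>, whose energy
  may lie above \<open>E (x n)\<close>, or even below \<open>Es\<close>. As \<open>E\<close> is convex up to a quadratic
  (\<open>objective_on_segment\<close>, where the gradient of \<open>g2\<close> is Lipschitz) and the step lengths are bounded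
  below, \<open>E (u n) - Es \<ge> r n - C * (r n - r (n + 1))\<close>. Hence there is an alternative:
  either \<open>r n \<le> 2 * C * (r n - r (n + 1))\<close>, a linear contraction, or \<open>E (u n) - Es \<ge> r n / 2\<close> and the KL
  inequality at \<open>u n\<close> bounds \<open>r n powr \<theta>\<close> by a multiple of \<open>d n + d (n - 1)\<close>. In the first case
  \<open>d n\<close> is paid for by the decrease of \<open>sqrt r\<close>, in the second one by the decrease of
  \<open>r powr (1 - \<theta>)\<close> and a quarter of \<open>d n + d (n - 1)\<close>; summing gives finite length
  (\<open>finite_length_of_alternative\<close>).

  The KL inequality is local, around each critical point. A constant valid along the whole tail of
  \<open>u\<close> comes from compactness (\<open>KL_along_sequence\<close>), since every cluster point of \<open>u\<close> is critical
  with energy \<open>Es\<close> (\<open>subdiff_closed\<close>).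
\<close>

section \<open>First-order convex analysis\<close>

text \<open>By the Riesz representation of the derivative.\<close>

lemma differentiable_GDERIV_grad:
  fixes f :: "'a::euclidean_space \<Rightarrow> real"
  assumes "f differentiable (at x)"
  shows "GDERIV f x :> grad f x"
proof -
  obtain D where D: "(f has_derivative D) (at x)"
    using assms by (auto simp: differentiable_def)
  then have lin: "linear D"
    by (rule has_derivative_linear)
  define v where "v = adjoint D 1"
  have "D h = inner h v" for h
    using adjoint_works[OF lin, of h 1] by (simp add: v_def)
  then have "D = (\<lambda>h. inner h v)" by blast
  with D have "GDERIV f x :> v"
    by (simp add: gderiv_def)
  then show ?thesis
    using grad_eqI by metis
qed

lemma GDERIV_directional:
  fixes f :: "'a::real_inner \<Rightarrow> real"
  assumes "GDERIV f x :> D"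
  shows "((\<lambda>t. (f (x + t *\<^sub>R h) - f x) / t) \<longlongrightarrow> inner D h) (at_right 0)"
proof -
  have "(f has_derivative (\<lambda>k. inner k D)) (at (x + 0 *\<^sub>R h))"
    using assms by (simp add: gderiv_def)
  moreover have "((\<lambda>t. x + t *\<^sub>R h) has_derivative (\<lambda>t. t *\<^sub>R h)) (at 0)"
    by (auto intro!: derivative_eq_intros)
  ultimately have "((\<lambda>t. f (x + t *\<^sub>R h)) has_derivative (\<lambda>t. inner (t *\<^sub>R h) D)) (at 0)"
    using has_derivative_compose[of "\<lambda>t. x + t *\<^sub>R h" "\<lambda>t. t *\<^sub>R h" 0 UNIV f "\<lambda>k. inner k D"] by simp
  then have "((\<lambda>t. f (x + t *\<^sub>R h)) has_field_derivative inner D h) (at 0)"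
    by (simp add: has_field_derivative_def inner_commute mult.commute mult_commute_abs)
  then have "((\<lambda>t. (f (x + t *\<^sub>R h) - f x) / t) \<longlongrightarrow> inner D h) (at 0)"
    by (simp add: DERIV_def)
  then show ?thesis
    using tendsto_mono[OF at_le[of "{0<..}" UNIV "0::real"]] by blast
qed

lemma convex_gradient_below:
  fixes f :: "'a::real_inner \<Rightarrow> real"
  assumes conv: "convex_on UNIV f" and D: "GDERIV f x :> D"
  shows "f x + inner D (z - x) \<le> f z"
proof -
  have "\<forall>\<^sub>F t in at_right 0. (f (x + t *\<^sub>R (z - x)) - f x) / t \<le> f z - f x"
    unfolding eventually_at_right_field
  proof (intro exI conjI allI impI)
    fix t :: real
    assume t: "0 < t" "t < 1"
    have "f ((1 - t) *\<^sub>R x + t *\<^sub>R z) \<le> (1 - t) * f x + t * f z"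
      using t by (intro convex_onD[OF conv]) auto
    moreover have "(1 - t) *\<^sub>R x + t *\<^sub>R z = x + t *\<^sub>R (z - x)"
      by (simp add: algebra_simps)
    ultimately show "(f (x + t *\<^sub>R (z - x)) - f x) / t \<le> f z - f x"
      using t by (simp add: field_simps)
  qed auto
  then have "inner D (z - x) \<le> f z - f x"
    using tendsto_upperbound[OF GDERIV_directional[OF D]] by simp
  then show ?thesis by simp
qed

text \<open>Fermat's rule for a smooth plus a convex function. Comparing \<open>u\<close> with points of the segment
  towards \<open>z\<close>, where \<open>g\<close> is below its chord, and dividing by the distance turns minimality into
  the subgradient inequality for \<open>g\<close> alone.\<close>

lemma subgradient_at_minimizer:
  fixes s :: "'a::real_inner \<Rightarrow> real"
  assumes D: "GDERIV s u :> p"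
    and conv: "convex_ereal_fun g" and proper: "\<And>z. g z \<noteq> - \<infinity>" and fin: "\<bar>g u\<bar> \<noteq> \<infinity>"
    and min: "\<And>z. ereal (s u) + g u \<le> ereal (s z) + g z"
  shows "- p \<in> subdifferential g u"
proof -
  have "g u + ereal (inner (- p) (z - u)) \<le> g z" for z
  proof (cases "g z")
    case (real b)
    obtain a where a: "g u = ereal a" using fin by auto
    have "\<forall>\<^sub>F t in at_right 0. a - b \<le> (s (u + t *\<^sub>R (z - u)) - s u) / t"
      unfolding eventually_at_right_field
    proof (intro exI conjI allI impI)
      fix t :: real
      assume t: "0 < t" "t < 1"
      have eq: "(1 - t) *\<^sub>R u + t *\<^sub>R z = u + t *\<^sub>R (z - u)"
        by (simp add: algebra_simps)
      have "g (u + t *\<^sub>R (z - u)) \<le> ereal (1 - t) * g u + ereal t * g z"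
        using conv t unfolding convex_ereal_fun_def eq[symmetric] by blast
      also have "\<dots> = ereal ((1 - t) * a + t * b)" by (simp add: a real)
      finally have "ereal (s u) + g u \<le> ereal (s (u + t *\<^sub>R (z - u))) + ereal ((1 - t) * a + t * b)"
        by (intro order_trans[OF min add_left_mono])
      then show "a - b \<le> (s (u + t *\<^sub>R (z - u)) - s u) / t"
        using t a by (simp add: field_simps)
    qed auto
    then have "a - b \<le> inner p (z - u)"
      using tendsto_lowerbound[OF GDERIV_directional[OF D]] by simp
    then show ?thesis using a real by simp
  qed (use proper in auto)
  then show ?thesis using fin by (simp add: subdifferential_def)
qed

lemma subdifferential_differentiable:
  fixes g :: "'a::real_inner \<Rightarrow> real"
  assumes D: "GDERIV g x :> D" and sub: "\<xi> \<in> subdifferential (\<lambda>z. ereal (g z)) x"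
  shows "\<xi> = D"
proof -
  have "inner \<xi> h \<le> inner D h" for h
  proof (rule tendsto_lowerbound[OF GDERIV_directional[OF D]])
    show "\<forall>\<^sub>F t in at_right 0. inner \<xi> h \<le> (g (x + t *\<^sub>R h) - g x) / t"
      unfolding eventually_at_right_field
    proof (intro exI conjI allI impI)
      fix t :: real
      assume t: "0 < t" "t < 1"
      have "ereal (g x) + ereal (inner \<xi> (x + t *\<^sub>R h - x)) \<le> ereal (g (x + t *\<^sub>R h))"
        using sub unfolding subdifferential_def by blast
      then show "inner \<xi> h \<le> (g (x + t *\<^sub>R h) - g x) / t"
        using t by (simp add: field_simps)
    qed auto
  qed simp
  from this[of "\<xi> - D"] have "inner (\<xi> - D) (\<xi> - D) \<le> 0"
    by (simp add: inner_diff_left)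
  then show ?thesis
    by (metis inner_eq_zero_iff inner_ge_zero order_antisym right_minus_eq)
qed

text \<open>Convexity at the far endpoint \<open>z\<close>, followed by Cauchy-Schwarz. The constant \<open>M\<close> instead of the
  sharp \<open>M / 2\<close> avoids integrating along the segment.\<close>

lemma lipschitz_gradient_above:
  fixes g :: "'a::real_inner \<Rightarrow> real"
  assumes conv: "convex_on UNIV g" and D: "\<And>z. GDERIV g z :> grad g z"
    and lip: "M-lipschitz_on UNIV (grad g)"
  shows "g z \<le> g u + inner (grad g u) (z - u) + M * (norm (z - u))\<^sup>2"
proof -
  have "g z + inner (grad g z) (u - z) \<le> g u"
    by (rule convex_gradient_below[OF conv D])
  then have "g z \<le> g u + inner (grad g u) (z - u) + inner (grad g z - grad g u) (z - u)"
    by (simp add: inner_diff_left inner_diff_right algebra_simps)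
  also have "inner (grad g z - grad g u) (z - u) \<le> norm (grad g z - grad g u) * norm (z - u)"
    by (rule norm_cauchy_schwarz)
  also have "\<dots> \<le> M * norm (z - u) * norm (z - u)"
    using lipschitz_onD[OF lip, of z u] by (intro mult_right_mono) (auto simp: dist_norm)
  finally show ?thesis by (simp add: power2_eq_square mult.assoc)
qed

text \<open>The limit inferior in \<open>lsc_fun\<close> is over a punctured neighbourhood, whereas the sequence may hit
  its limit.\<close>

lemma lsc_fun_sequentially:
  fixes g :: "'a::t2_space \<Rightarrow> ereal"
  assumes lsc: "lsc_fun g" and u: "u \<longlonglongrightarrow> a" and lim: "(\<lambda>n. g (u n)) \<longlonglongrightarrow> b"
  shows "g a \<le> b"
proof (rule ccontr)
  assume "\<not> g a \<le> b"
  then have "b < g a" by simp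
  then obtain c where c: "b < c" "c < g a"
    by (auto dest: dense)
  have "g a \<le> Liminf (at a) g"
    using lsc by (simp add: lsc_fun_def)
  with c(2) have "c < Liminf (at a) g"
    by (rule less_le_trans)
  then have "\<forall>\<^sub>F z in at a. c < g z"
    by (rule less_LiminfD)
  then have "\<forall>\<^sub>F z in nhds a. c < g z"
    unfolding eventually_at_filter
  proof (rule eventually_mono)
    show "c < g z" if "z \<noteq> a \<longrightarrow> z \<in> UNIV \<longrightarrow> c < g z" for z
      using that c(2) by (cases "z = a") auto
  qed
  then have "\<forall>\<^sub>F n in sequentially. c < g (u n)"
    using u by (rule eventually_compose_filterlim)
  then have "\<forall>\<^sub>F n in sequentially. c \<le> g (u n)"
    by (rule eventually_mono) simp
  then have "c \<le> b"
    using lim by (intro tendsto_lowerbound) auto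
  with c show False by simp
qed

section \<open>Finite length from a decrease and a KL-type alternative\<close>

text \<open>The tangent inequality at \<open>r\<close> for the concave function \<open>\<lambda>s. s powr (1 - \<theta>)\<close>, multiplied by
  \<open>r powr \<theta>\<close> so that it survives \<open>r = 0\<close>.\<close>

lemma powr_concave_gap:
  fixes r r' \<theta> :: real
  assumes "0 \<le> r'" "r' \<le> r" "0 \<le> \<theta>" "\<theta> < 1"
  shows "(1 - \<theta>) * (r - r') \<le> r powr \<theta> * (r powr (1 - \<theta>) - r' powr (1 - \<theta>))"
proof (cases "r' = 0 \<or> r' = r")
  case True
  have "(1 - \<theta>) * r \<le> r"
    using assms by (intro mult_left_le_one_le) auto
  moreover have "r powr \<theta> * r powr (1 - \<theta>) = r"
    using assms by (simp flip: powr_add)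
  ultimately show ?thesis using True by auto
next
  case False
  then have "0 < r'" "r' < r" using assms by simp_all
  then have "\<exists>z. r' < z \<and> z < r \<and> r powr (1 - \<theta>) - r' powr (1 - \<theta>)
      = (r - r') * ((1 - \<theta>) * z powr (1 - \<theta> - 1))"
    using assms by (intro MVT2) (auto intro!: derivative_eq_intros)
  then obtain z where z: "r' < z" "z < r"
    "r powr (1 - \<theta>) - r' powr (1 - \<theta>) = (r - r') * ((1 - \<theta>) * z powr (- \<theta>))"
    by auto
  have "1 = z powr \<theta> * z powr (- \<theta>)"
    using z \<open>0 < r'\<close> assms by (simp flip: powr_add)
  also have "\<dots> \<le> r powr \<theta> * z powr (- \<theta>)"
    using z \<open>0 < r'\<close> assms by (intro mult_right_mono powr_mono2) auto
  finally have "(1 - \<theta>) * (r - r') * 1 \<le> (1 - \<theta>) * (r - r') * (r powr \<theta> * z powr (- \<theta>))"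
    using assms by (intro mult_left_mono) auto
  then show ?thesis using z(3) by (simp add: mult_ac)
qed

lemma summable_of_potential:
  fixes a V :: "nat \<Rightarrow> real"
  assumes "\<And>n. 0 \<le> a n" "\<And>n. 0 \<le> V n" "\<And>n. a (Suc n) \<le> V n - V (Suc n)"
  shows "summable a"
proof -
  have "sum (\<lambda>i. a (Suc i)) {..<n} \<le> V 0 - V n" for n
  proof (induction n)
    case (Suc n)
    then show ?case using assms(3)[of n] by simp
  qed simp
  then have "sum (\<lambda>i. a (Suc i)) {..<n} \<le> V 0" for n
    using assms(2)[of n] by (metis diff_ge_0_iff_ge diff_left_mono diff_zero order_trans)
  then have "summable (\<lambda>i. a (Suc i))"
    using assms(1) by (intro bounded_imp_summable[where B = "V 0"])
      (simp_all only: lessThan_Suc_atMost[symmetric])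
  then show ?thesis by (simp add: summable_Suc_iff)
qed

text \<open>Think of \<open>r\<close> as the energy gap and of \<open>a\<close> as the step lengths. Each step is bounded by the drop
  of the potential \<open>P = M * r powr (1 - \<theta>) + M' * sqrt r\<close>, up to a quarter of the last two steps;
  the two summands of \<open>P\<close> serve the two cases of \<open>alt\<close>.\<close>

lemma finite_length_of_alternative:
  fixes r a :: "nat \<Rightarrow> real"
  assumes r: "\<And>n. 0 \<le> r n" and a: "\<And>n. 0 \<le> a n"
    and c: "0 < c" and C: "0 < C" and K: "0 < K" and \<theta>: "0 \<le> \<theta>" "\<theta> < 1"
    and dec: "\<And>n. c * (a n)\<^sup>2 \<le> r n - r (Suc n)"
    and alt: "\<And>n. r (Suc n) \<le> C * (r (Suc n) - r (Suc (Suc n))) \<or>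
               r (Suc n) powr \<theta> \<le> K * (a (Suc n) + a n)"
  shows "summable a"
proof -
  define M where "M = K / (c * (1 - \<theta>))"
  define M' where "M' = 2 * sqrt C / sqrt c"
  define P where "P = (\<lambda>n. M * r n powr (1 - \<theta>) + M' * sqrt (r n))"
  have M: "0 \<le> M" "0 \<le> M'" using c C K \<theta> by (auto simp: M_def M'_def)
  have mono: "r (Suc n) \<le> r n" for n
  proof -
    have "0 \<le> c * (a n)\<^sup>2" using c by simp
    then show ?thesis using dec[of n] by linarith
  qed
  have step: "a (Suc n) \<le> (a (Suc n) + a n) / 4 + (P (Suc n) - P (Suc (Suc n)))" for n
  proof -
    define R R' where "R = r (Suc n)" and "R' = r (Suc (Suc n))"
    have R: "0 \<le> R" "0 \<le> R'" "R' \<le> R" using r mono by (auto simp: R_def R'_def)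
    define A where "A = a (Suc n)"
    define p where "p = a (Suc n) + a n"
    have A: "0 \<le> A" "0 \<le> p" using a by (auto simp: A_def p_def)
    have cA: "c * A\<^sup>2 \<le> R - R'" using dec[of "Suc n"] by (simp add: A_def R_def R'_def)
    have gaps: "R' powr (1 - \<theta>) \<le> R powr (1 - \<theta>)" "sqrt R' \<le> sqrt R"
      using R \<theta> by (auto intro: powr_mono2)
    have "A \<le> p / 4 + (M * (R powr (1 - \<theta>) - R' powr (1 - \<theta>)) + M' * (sqrt R - sqrt R'))"
      using alt[of n]
    proof
      assume "r (Suc n) \<le> C * (r (Suc n) - r (Suc (Suc n)))"
      then have RC: "R \<le> C * (R - R')" by (simp add: R_def R'_def)
      have "A \<le> M' * (sqrt R - sqrt R')"
      proof (cases "R = 0")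
        case True
        then have "c * A\<^sup>2 \<le> 0" using cA R by simp
        then have "A = 0" using c by (simp add: mult_le_0_iff)
        then show ?thesis using M gaps by simp
      next
        case False
        then have Rpos: "0 < R" using R by simp
        from RC have sR: "sqrt R \<le> sqrt C * sqrt (R - R')"
          by (metis real_sqrt_le_iff real_sqrt_mult)
        have pos: "0 < sqrt (R - R')"
        proof -
          have "0 < sqrt R" using Rpos by simp
          then have "0 < sqrt C * sqrt (R - R')" using sR by linarith
          then show ?thesis using C by (simp add: zero_less_mult_iff)
        qed
        have "sqrt (R - R') * sqrt (R - R') = (sqrt R - sqrt R') * (sqrt R + sqrt R')"
          using R by (simp add: algebra_simps)
        also have "\<dots> \<le> (sqrt R - sqrt R') * (2 * (sqrt C * sqrt (R - R')))"
        proof (intro mult_left_mono)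
          show "sqrt R + sqrt R' \<le> 2 * (sqrt C * sqrt (R - R'))"
            using sR gaps(2) by linarith
          show "0 \<le> sqrt R - sqrt R'" using gaps(2) by linarith
        qed
        finally have "sqrt (R - R') * sqrt (R - R')
            \<le> (2 * sqrt C * (sqrt R - sqrt R')) * sqrt (R - R')"
          by (simp only: mult_ac)
        then have "sqrt (R - R') \<le> 2 * sqrt C * (sqrt R - sqrt R')"
          using pos by (rule mult_right_le_imp_le)
        moreover have "sqrt c * A \<le> sqrt (R - R')"
          using real_sqrt_le_mono[OF cA] A by (simp add: real_sqrt_mult)
        ultimately have "sqrt c * A \<le> 2 * sqrt C * (sqrt R - sqrt R')" by linarith
        then show ?thesis
          using c by (simp add: M'_def pos_le_divide_eq mult.commute)
      qed
      moreover have "0 \<le> M * (R powr (1 - \<theta>) - R' powr (1 - \<theta>))" using M gaps by simp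
      ultimately show ?thesis using A by linarith
    next
      assume "r (Suc n) powr \<theta> \<le> K * (a (Suc n) + a n)"
      then have kl: "R powr \<theta> \<le> K * p" by (simp add: R_def p_def)
      define q where "q = M * (R powr (1 - \<theta>) - R' powr (1 - \<theta>))"
      have q: "0 \<le> q" using M gaps by (simp add: q_def)
      \<comment> \<open>Concavity converts the energy drop into a drop \<open>q\<close> of the potential, and \<open>A\<^sup>2 \<le> p * q\<close> is
        split by the inequality between geometric and arithmetic means.\<close>
      have "(1 - \<theta>) * (c * A\<^sup>2) \<le> (1 - \<theta>) * (R - R')"
        using cA \<theta> by (intro mult_left_mono) auto
      also have "\<dots> \<le> R powr \<theta> * (R powr (1 - \<theta>) - R' powr (1 - \<theta>))"
        using R \<theta> by (intro powr_concave_gap)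
      also have "\<dots> \<le> K * p * (R powr (1 - \<theta>) - R' powr (1 - \<theta>))"
        using kl gaps by (intro mult_right_mono) auto
      finally have "(c * (1 - \<theta>)) * A\<^sup>2 \<le> K * p * (R powr (1 - \<theta>) - R' powr (1 - \<theta>))"
        by (simp add: mult_ac)
      then have "A\<^sup>2 \<le> K * p * (R powr (1 - \<theta>) - R' powr (1 - \<theta>)) / (c * (1 - \<theta>))"
        using c \<theta> by (subst pos_le_divide_eq) (simp_all add: mult.commute)
      also have "\<dots> = p * q" by (simp add: q_def M_def)
      finally have "A\<^sup>2 \<le> p * q" .
      also have "p * q \<le> (p / 4 + q)\<^sup>2"
      proof -
        have "(p / 4 + q)\<^sup>2 = (p / 4 - q)\<^sup>2 + p * q"
          by (simp add: power2_eq_square algebra_simps)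
        then show ?thesis by simp
      qed
      finally have "A\<^sup>2 \<le> (p / 4 + q)\<^sup>2" .
      then have "A \<le> p / 4 + q"
        by (rule power2_le_imp_le) (use A q in linarith)
      moreover have "0 \<le> M' * (sqrt R - sqrt R')" using M gaps by simp
      ultimately show ?thesis by (simp add: q_def)
    qed
    then show ?thesis by (simp add: A_def p_def R_def R'_def P_def algebra_simps)
  qed
  have P: "0 \<le> P n" for n using M r[of n] by (simp add: P_def)
  \<comment> \<open>Absorbing the quarter terms leaves \<open>3 * a (Suc n) \<le> a n + 4 * (P (Suc n) - P (Suc (Suc n)))\<close>.\<close>
  show ?thesis
  proof (rule summable_of_potential[where V = "\<lambda>n. 2 * (a n / 4 + P (Suc n))"])
    show "a (Suc n) \<le> 2 * (a n / 4 + P (Suc n)) - 2 * (a (Suc n) / 4 + P (Suc (Suc n)))" for n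
      using step[of n] by (simp add: field_simps)
  qed (use a P in auto)
qed

section \<open>Difference-of-convex objectives\<close>

locale dc_composite =
  fixes f g2 :: "'a::euclidean_space \<Rightarrow> real" and g1 :: "'a \<Rightarrow> ereal" and M :: real
  assumes f_convex: "convex_on UNIV f"
    and f_gderiv: "\<And>z. GDERIV f z :> grad f z"
    and f_C1: "continuous_on UNIV (grad f)"
    and g1_proper: "proper_fun g1"
    and g1_lsc: "lsc_fun g1"
    and g1_convex: "convex_ereal_fun g1"
    and g2_convex: "convex_on UNIV g2"
    and g2_gderiv: "\<And>z. GDERIV g2 z :> grad g2 z"
    and g2_lipschitz: "M-lipschitz_on UNIV (grad g2)"
begin

abbreviation "E \<equiv> objective f g1 g2"
abbreviation "e z \<equiv> real_of_ereal (objective f g1 g2 z)"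
abbreviation "dE \<equiv> objective_subdiff f g1 g2"

lemma M_nonneg: "0 \<le> M"
  using g2_lipschitz by (rule lipschitz_on_nonneg)

lemma g1_not_MInf: "g1 z \<noteq> - \<infinity>"
  using g1_proper by (simp add: proper_fun_def)

lemma objective_not_MInf: "E z \<noteq> - \<infinity>"
  using g1_not_MInf[of z] by (cases "g1 z") (auto simp: objective_def)

lemma objective_finite_iff: "\<bar>E z\<bar> \<noteq> \<infinity> \<longleftrightarrow> \<bar>g1 z\<bar> \<noteq> \<infinity>"
  by (cases "g1 z") (auto simp: objective_def)

lemma objective_real:
  assumes "g1 z = ereal b"
  shows "E z = ereal (f z + b - g2 z)" "e z = f z + b - g2 z"
  using assms by (simp_all add: objective_def)

lemma subdiff_finite:
  assumes "w \<in> dE u"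
  shows "\<bar>E u\<bar> \<noteq> \<infinity>" "\<bar>g1 u\<bar> \<noteq> \<infinity>"
  using assms by (auto simp: objective_subdiff_def subdifferential_def objective_finite_iff)

lemma continuous_f: "isCont f z"
  using f_gderiv[of z] unfolding gderiv_def by (rule has_derivative_continuous)

lemma continuous_g2: "isCont g2 z"
  using g2_gderiv[of z] unfolding gderiv_def by (rule has_derivative_continuous)

text \<open>A subgradient of the nonconvex \<open>E\<close> still yields a lower model, with a quadratic defect that
  comes from the concave part \<open>- g2\<close>.\<close>

lemma subdiff_model_below:
  assumes w: "w \<in> dE u" and fin: "\<bar>E z\<bar> \<noteq> \<infinity>"
  shows "e u + inner w (z - u) - M * (norm (z - u))\<^sup>2 \<le> e z"
proof -
  obtain v where v: "v \<in> subdifferential g1 u" "w = grad f u + v - grad g2 u"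
    using w by (auto simp: objective_subdiff_def)
  obtain a b where ab: "g1 u = ereal a" "g1 z = ereal b"
    using subdiff_finite(2)[OF w] fin by (auto simp: objective_finite_iff)
  have "g1 u + ereal (inner v (z - u)) \<le> g1 z"
    using v(1) unfolding subdifferential_def by blast
  then have "a + inner v (z - u) \<le> b" by (simp add: ab)
  moreover have "f u + inner (grad f u) (z - u) \<le> f z"
    by (rule convex_gradient_below[OF f_convex f_gderiv])
  moreover have "g2 z \<le> g2 u + inner (grad g2 u) (z - u) + M * (norm (z - u))\<^sup>2"
    by (rule lipschitz_gradient_above[OF g2_convex g2_gderiv g2_lipschitz])
  ultimately show ?thesis
    by (simp add: objective_real[OF ab(1)] objective_real[OF ab(2)] v(2) inner_diff_left inner_add_left)
qed

text \<open>Convexity of \<open>E\<close> up to a quadratic. With \<open>t\<close> bounded away from zero it bounds \<open>e u\<close> from below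
  in terms of the values at \<open>x\<close> and at the intermediate point.\<close>

lemma objective_on_segment:
  assumes fin: "\<bar>E x\<bar> \<noteq> \<infinity>" "\<bar>E u\<bar> \<noteq> \<infinity>" "\<bar>E (x + t *\<^sub>R (u - x))\<bar> \<noteq> \<infinity>"
    and t: "0 < t" "t \<le> 1"
  shows "e (x + t *\<^sub>R (u - x)) \<le> (1 - t) * e x + t * e u + M * (norm (u - x))\<^sup>2"
proof (cases "t = 1")
  case True
  then show ?thesis using M_nonneg by simp
next
  case False
  then have t1: "t < 1" using t by simp
  define p where "p = x + t *\<^sub>R (u - x)"
  have p: "p = (1 - t) *\<^sub>R x + t *\<^sub>R u" by (simp add: p_def algebra_simps)
  obtain a b c where abc: "g1 x = ereal a" "g1 u = ereal b" "g1 p = ereal c"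
    using fin by (auto simp: objective_finite_iff p_def)
  have "g1 p \<le> ereal (1 - t) * g1 x + ereal t * g1 u"
    using g1_convex t t1 unfolding convex_ereal_fun_def p by blast
  then have 1: "c \<le> (1 - t) * a + t * b" using abc by simp
  have 2: "f p \<le> (1 - t) * f x + t * f u"
    unfolding p using t by (intro convex_onD[OF f_convex]) auto
  let ?D = "(norm (u - x))\<^sup>2"
  have up: "g2 z \<le> g2 p + inner (grad g2 p) (z - p) + M * (norm (z - p))\<^sup>2" for z
    by (rule lipschitz_gradient_above[OF g2_convex g2_gderiv g2_lipschitz])
  have xp: "x - p = (- t) *\<^sub>R (u - x)" and upd: "u - p = (1 - t) *\<^sub>R (u - x)"
    by (simp_all add: p_def algebra_simps)
  have 3: "g2 x \<le> g2 p - t * inner (grad g2 p) (u - x) + M * t\<^sup>2 * ?D"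
    using up[of x] unfolding xp norm_scaleR power_mult_distrib inner_scaleR_right
    by (simp add: mult.assoc)
  have 4: "g2 u \<le> g2 p + (1 - t) * inner (grad g2 p) (u - x) + M * (1 - t)\<^sup>2 * ?D"
    using up[of u] unfolding upd norm_scaleR power_mult_distrib inner_scaleR_right
    by (simp add: mult.assoc)
  have "(1 - t) * g2 x + t * g2 u \<le>
      (1 - t) * (g2 p - t * inner (grad g2 p) (u - x) + M * t\<^sup>2 * ?D)
      + t * (g2 p + (1 - t) * inner (grad g2 p) (u - x) + M * (1 - t)\<^sup>2 * ?D)"
    by (intro add_mono mult_left_mono 3 4) (use t t1 in auto)
  also have "\<dots> = g2 p + t * (1 - t) * (M * ?D)"
    by (simp add: power2_eq_square algebra_simps)
  also have "\<dots> \<le> g2 p + 1 * (M * ?D)"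
    using t t1 M_nonneg by (intro add_left_mono mult_right_mono mult_le_one) auto
  finally have 5: "(1 - t) * g2 x + t * g2 u \<le> g2 p + M * ?D" by simp
  show ?thesis
    using 1 2 5 unfolding p_def[symmetric]
    by (simp add: objective_real[OF abc(1)] objective_real[OF abc(2)] objective_real[OF abc(3)]
        distrib_left right_diff_distrib)
qed

text \<open>Along \<open>u\<close> the values of \<open>g1\<close> converge to some \<open>\<gamma>\<close> and its subgradients to some \<open>vb\<close>. Passing to the
  limit in the subgradient inequality gives an affine minorant of \<open>g1\<close> with value \<open>\<gamma>\<close> at \<open>xb\<close>, so
  \<open>\<gamma> \<le> g1 xb\<close>; lower semicontinuity is the reverse inequality. This gives criticality and the
  continuity of \<open>E\<close> along \<open>u\<close> at once.\<close>

lemma subdiff_closed: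
  assumes w: "\<And>k. w k \<in> dE (u k)"
    and u: "u \<longlonglongrightarrow> xb" and w0: "w \<longlonglongrightarrow> 0" and Es: "(\<lambda>k. e (u k)) \<longlonglongrightarrow> Es"
  shows "critical_point f g1 g2 xb" "E xb = ereal Es"
proof -
  define \<gamma> where "\<gamma> = Es - f xb + g2 xb"
  define v where "v = (\<lambda>k. w k - grad f (u k) + grad g2 (u k))"
  define vb where "vb = grad g2 xb - grad f xb"
  define b where "b = (\<lambda>k. real_of_ereal (g1 (u k)))"
  have b: "g1 (u k) = ereal (b k)" for k
    using subdiff_finite(2)[OF w[of k]] by (auto simp: b_def)
  have v: "v k \<in> subdifferential g1 (u k)" for k
    using w[of k] by (auto simp: objective_subdiff_def v_def)
  have "continuous_on UNIV (grad g2)"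
    by (rule lipschitz_on_continuous_on[OF g2_lipschitz])
  then have cont: "isCont (grad g2) xb" "isCont (grad f) xb"
    using f_C1 by (simp_all add: continuous_on_eq_continuous_at)
  have "v \<longlonglongrightarrow> 0 - grad f xb + grad g2 xb"
    unfolding v_def
    by (intro tendsto_add tendsto_diff w0 isCont_tendsto_compose[OF cont(1) u]
        isCont_tendsto_compose[OF cont(2) u])
  then have vlim: "v \<longlonglongrightarrow> vb" by (simp add: vb_def)
  have "(\<lambda>k. e (u k) - f (u k) + g2 (u k)) \<longlonglongrightarrow> \<gamma>"
    unfolding \<gamma>_def
    by (intro tendsto_add tendsto_diff Es isCont_tendsto_compose[OF continuous_f u]
        isCont_tendsto_compose[OF continuous_g2 u])
  moreover have "e (u k) - f (u k) + g2 (u k) = b k" for k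
    using objective_real(2)[OF b] by simp
  ultimately have blim: "b \<longlonglongrightarrow> \<gamma>" by simp
  have below: "ereal (\<gamma> + inner vb (z - xb)) \<le> g1 z" for z
  proof (rule tendsto_upperbound)
    show "(\<lambda>k. ereal (b k + inner (v k) (z - u k))) \<longlonglongrightarrow> ereal (\<gamma> + inner vb (z - xb))"
      using blim vlim u by (intro tendsto_intros)
    have "ereal (b k + inner (v k) (z - u k)) \<le> g1 z" for k
      using v[of k] b[of k] by (simp add: subdifferential_def)
    then show "\<forall>\<^sub>F k in sequentially. ereal (b k + inner (v k) (z - u k)) \<le> g1 z"
      by simp
  qed simp
  have "g1 xb \<le> ereal \<gamma>"
    using lsc_fun_sequentially[OF g1_lsc u, of "ereal \<gamma>"] blim by (simp add: b)
  with below[of xb] have g1xb: "g1 xb = ereal \<gamma>" by simp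
  then have "vb \<in> subdifferential g1 xb"
    using below by (simp add: subdifferential_def)
  then have "grad f xb + vb - grad g2 xb \<in> dE xb"
    unfolding objective_subdiff_def by blast
  then show "critical_point f g1 g2 xb" by (simp add: critical_point_def vb_def)
  show "E xb = ereal Es" using objective_real(1)[OF g1xb] by (simp add: \<gamma>_def)
qed

text \<open>If no constant worked, then for each \<open>k\<close> the inequality with constant \<open>1 / (k + 1)\<close> would fail at
  some index beyond \<open>k\<close>. A cluster point of these \<open>u\<close> is critical with energy \<open>Es\<close>, and the KL
  inequality around it is contradicted for large \<open>k\<close>.\<close>

lemma KL_along_sequence:
  assumes KL: "KL_exponent f g1 g2 \<theta>"
    and w: "\<And>n. w n \<in> dE (u n)"
    and u: "bounded (range u)" and w0: "w \<longlonglongrightarrow> 0" and Es: "(\<lambda>n. e (u n)) \<longlonglongrightarrow> Es"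
  shows "\<exists>c>0. \<forall>\<^sub>F n in sequentially. Es < e (u n) \<longrightarrow> c * (e (u n) - Es) powr \<theta> \<le> norm (w n)"
proof (rule ccontr)
  assume neg: "\<not> ?thesis"
  have "\<exists>n\<ge>k. Es < e (u n) \<and> norm (w n) < 1 / (real k + 1) * (e (u n) - Es) powr \<theta>" for k
  proof -
    have "0 < 1 / (real k + 1)" by simp
    then have "\<not> (\<forall>\<^sub>F n in sequentially. Es < e (u n) \<longrightarrow>
        1 / (real k + 1) * (e (u n) - Es) powr \<theta> \<le> norm (w n))"
      using neg by blast
    then show ?thesis
      unfolding eventually_sequentially by (meson not_le)
  qed
  then obtain \<sigma> where \<sigma>: "\<And>k. k \<le> \<sigma> k" "\<And>k. Es < e (u (\<sigma> k))"
    "\<And>k. norm (w (\<sigma> k)) < 1 / (real k + 1) * (e (u (\<sigma> k)) - Es) powr \<theta>"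
    by metis
  have \<sigma>lim: "filterlim \<sigma> at_top sequentially"
    by (rule filterlim_at_top_mono[OF filterlim_ident]) (simp add: \<sigma>(1))
  have "bounded (range (u \<circ> \<sigma>))"
    using u by (rule bounded_subset) auto
  then obtain xb s where s: "strict_mono s" "((u \<circ> \<sigma>) \<circ> s) \<longlonglongrightarrow> xb"
    using bounded_imp_convergent_subsequence by blast
  define \<tau> where "\<tau> = \<sigma> \<circ> s"
  have \<tau>: "filterlim \<tau> at_top sequentially"
    unfolding \<tau>_def comp_def by (rule filterlim_compose[OF \<sigma>lim filterlim_subseq[OF s(1)]])
  have ulim: "(\<lambda>k. u (\<tau> k)) \<longlonglongrightarrow> xb"
    using s(2) by (simp add: \<tau>_def comp_def)
  have elim': "(\<lambda>k. e (u (\<tau> k))) \<longlonglongrightarrow> Es"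
    by (rule filterlim_compose[OF Es \<tau>])
  have wlim: "(\<lambda>k. w (\<tau> k)) \<longlonglongrightarrow> 0"
    by (rule filterlim_compose[OF w0 \<tau>])
  have crit: "critical_point f g1 g2 xb"
    by (rule subdiff_closed(1)[OF w ulim wlim elim'])
  have Exb: "E xb = ereal Es"
    by (rule subdiff_closed(2)[OF w ulim wlim elim'])
  obtain c \<epsilon> \<nu> where c: "0 < c" and \<epsilon>: "0 < \<epsilon>" and \<nu>: "(0::ereal) < \<nu>"
    and kl: "\<And>x. norm (x - xb) \<le> \<epsilon> \<Longrightarrow> E xb < E x \<Longrightarrow> E x < E xb + \<nu> \<Longrightarrow>
        ereal (c * real_of_ereal (E x - E xb) powr \<theta>) \<le> dist0 (dE x)"
    using KL crit unfolding KL_exponent_def by meson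
  have "\<forall>\<^sub>F k in sequentially. dist (u (\<tau> k)) xb < \<epsilon>"
    using ulim \<epsilon> by (rule tendstoD)
  moreover have "\<forall>\<^sub>F k in sequentially. ereal (e (u (\<tau> k))) < ereal Es + \<nu>"
  proof (rule order_tendstoD(2))
    show "(\<lambda>k. ereal (e (u (\<tau> k)))) \<longlonglongrightarrow> ereal Es" using elim' by (rule tendsto_ereal)
    show "ereal Es < ereal Es + \<nu>" using \<nu> by (cases \<nu>) auto
  qed
  moreover have "\<forall>\<^sub>F k in sequentially. 1 / (real (s k) + 1) < c"
  proof (rule order_tendstoD(2)[OF _ c])
    have "(\<lambda>k. 1 / (real k + 1)) \<longlonglongrightarrow> 0"
      using LIMSEQ_inverse_real_of_nat by (simp add: inverse_eq_divide add.commute)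
    then show "(\<lambda>k. 1 / (real (s k) + 1)) \<longlonglongrightarrow> 0"
      by (rule filterlim_compose[OF _ filterlim_subseq[OF s(1)]])
  qed
  ultimately have "\<forall>\<^sub>F k in sequentially. dist (u (\<tau> k)) xb < \<epsilon> \<and>
      ereal (e (u (\<tau> k))) < ereal Es + \<nu> \<and> 1 / (real (s k) + 1) < c"
    by eventually_elim simp
  then obtain k where k: "dist (u (\<tau> k)) xb < \<epsilon>" "ereal (e (u (\<tau> k))) < ereal Es + \<nu>"
      "1 / (real (s k) + 1) < c"
    using eventually_happens' sequentially_bot by fast
  define a where "a = e (u (\<tau> k))"
  have Eu: "E (u (\<tau> k)) = ereal a"
    using subdiff_finite(1)[OF w[of "\<tau> k"]] by (simp add: ereal_real a_def)
  have gap: "Es < a" using \<sigma>(2) by (simp add: \<tau>_def a_def)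
  have "ereal (c * real_of_ereal (E (u (\<tau> k)) - E xb) powr \<theta>) \<le> dist0 (dE (u (\<tau> k)))"
  proof (rule kl)
    show "norm (u (\<tau> k) - xb) \<le> \<epsilon>" using k(1) by (simp add: dist_norm)
    show "E xb < E (u (\<tau> k))" unfolding Exb Eu using gap by simp
    have "ereal a < ereal Es + \<nu>" using k(2) by (simp only: a_def)
    then show "E (u (\<tau> k)) < E xb + \<nu>" by (simp only: Exb Eu)
  qed
  also have "\<dots> \<le> ereal (norm (w (\<tau> k)))"
    unfolding dist0_def by (rule INF_lower[OF w])
  finally have "c * (a - Es) powr \<theta> \<le> norm (w (\<tau> k))"
    unfolding Exb Eu by simp
  moreover have "norm (w (\<tau> k)) < 1 / (real (s k) + 1) * (a - Es) powr \<theta>"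
    using \<sigma>(3)[of "s k"] by (simp add: \<tau>_def a_def)
  moreover have "1 / (real (s k) + 1) * (a - Es) powr \<theta> \<le> c * (a - Es) powr \<theta>"
    using k(3) by (intro mult_right_mono) auto
  ultimately show False by linarith
qed

lemma finite_ereal_e: "\<bar>E z\<bar> \<noteq> \<infinity> \<Longrightarrow> E z = ereal (e z)"
  by (simp add: ereal_real)

text \<open>The convergence argument for any scheme with sufficient decrease at the iterates \<open>x\<close> and a relative
  error bound at auxiliary points \<open>u\<close>, where \<open>x\<close> moves a nonvanishing fraction \<open>t\<close> of the way to
  \<open>u\<close>.\<close>

theorem descent_convergence:
  fixes x u w :: "nat \<Rightarrow> 'a"
  assumes KL: "KL_exponent f g1 g2 \<theta>" and \<theta>: "0 \<le> \<theta>" "\<theta> < 1"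
    and below: "\<And>z. ereal m \<le> E z"
    and bdd: "bounded (range x)"
    and fin: "\<And>n. \<bar>E (x n)\<bar> \<noteq> \<infinity>"
    and step: "\<And>n. x (Suc n) = x n + t n *\<^sub>R (u n - x n)"
    and t: "\<And>n. tmin \<le> t n" "\<And>n. t n \<le> 1" and tmin: "0 < tmin"
    and w: "\<And>n. w n \<in> dE (u n)"
    and wK: "\<And>n. norm (w (Suc n)) \<le> K * (norm (u (Suc n) - x (Suc n)) + norm (u n - x n))"
    and K: "0 < K" and c: "0 < c"
    and dec: "\<And>n. e (x (Suc n)) \<le> e (x n) - c * (norm (u n - x n))\<^sup>2"
  shows "(\<exists>xs. critical_point f g1 g2 xs \<and> x \<longlonglongrightarrow> xs) \<and> summable (\<lambda>n. norm (x (Suc n) - x n))"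
proof -
  define d where "d = (\<lambda>n. norm (u n - x n))"
  have d_nonneg: "0 \<le> d n" for n by (simp add: d_def)
  have dec': "c * (d n)\<^sup>2 \<le> e (x n) - e (x (Suc n))" for n
    using dec[of n] by (simp add: d_def)
  have mono: "e (x (Suc n)) \<le> e (x n)" for n
  proof -
    have "0 \<le> c * (d n)\<^sup>2" using c by simp
    then show ?thesis using dec'[of n] by linarith
  qed
  have "m \<le> e (x n)" for n
    using below[of "x n"] by (subst (asm) finite_ereal_e[OF fin]) simp
  then obtain Es where Es: "(\<lambda>n. e (x n)) \<longlonglongrightarrow> Es" "\<And>n. Es \<le> e (x n)"
    using decseq_convergent[of "\<lambda>n. e (x n)" m] mono by (metis decseq_SucI)
  define r where "r = (\<lambda>n. e (x n) - Es)"
  have r_nonneg: "0 \<le> r n" for n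
    using Es(2)[of n] by (simp add: r_def)
  have r_dec: "c * (d n)\<^sup>2 \<le> r n - r (Suc n)" for n
    using dec'[of n] by (simp add: r_def)
  have r0: "r \<longlonglongrightarrow> 0"
    using tendsto_diff[OF Es(1) tendsto_const[of Es]] by (simp add: r_def)
  have gap0: "(\<lambda>n. r n - r (Suc n)) \<longlonglongrightarrow> 0"
    using tendsto_diff[OF r0 LIMSEQ_Suc[OF r0]] by simp
  have "(\<lambda>n. (d n)\<^sup>2) \<longlonglongrightarrow> 0"
  proof (rule tendsto_sandwich[where f = "\<lambda>_. 0"])
    show "(\<lambda>n. (r n - r (Suc n)) / c) \<longlonglongrightarrow> 0"
      using tendsto_divide[OF gap0 tendsto_const[of c]] c by simp
    show "\<forall>\<^sub>F n in sequentially. (d n)\<^sup>2 \<le> (r n - r (Suc n)) / c"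
      using r_dec c by (simp add: pos_le_divide_eq mult.commute)
  qed auto
  then have "(\<lambda>n. sqrt ((d n)\<^sup>2)) \<longlonglongrightarrow> sqrt 0" by (rule tendsto_real_sqrt)
  then have d0: "d \<longlonglongrightarrow> 0" by (simp add: d_def)
  then have ux0: "(\<lambda>n. u n - x n) \<longlonglongrightarrow> 0"
    by (simp add: d_def tendsto_norm_zero_iff)
  have "(\<lambda>n. K * (d (Suc n) + d n)) \<longlonglongrightarrow> K * (0 + 0)"
    by (intro tendsto_intros d0 LIMSEQ_Suc[OF d0])
  then have "(\<lambda>n. K * (d (Suc n) + d n)) \<longlonglongrightarrow> 0" by simp
  moreover have "\<forall>\<^sub>F n in sequentially. norm (w (Suc n)) \<le> K * (d (Suc n) + d n)"
    unfolding d_def by (intro always_eventually allI wK)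
  ultimately have "(\<lambda>n. w (Suc n)) \<longlonglongrightarrow> 0"
    by (rule Lim_null_comparison[rotated])
  then have w0: "w \<longlonglongrightarrow> 0" by (rule LIMSEQ_imp_Suc)
  have "bounded (range (\<lambda>n. u n - x n))"
    using ux0 by (rule convergent_imp_bounded)
  then have "bounded (range (\<lambda>n. x n + (u n - x n)))"
    using bdd by (intro bounded_plus_comp)
  then have u_bdd: "bounded (range u)" by simp

  \<comment> \<open>Solve \<open>objective_on_segment\<close> for \<open>e (u n)\<close>, with \<open>t n \<ge> tmin\<close> and \<open>(d n)\<^sup>2\<close> bounded by the decrease
    divided by \<open>c\<close>.\<close>
  define C where "C = (1 + M / c) / tmin"
  have C: "0 < C" using M_nonneg c tmin by (simp add: C_def add_pos_nonneg)
  have lower: "r n - C * (r n - r (Suc n)) \<le> e (u n) - Es" for n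
  proof -
    have tn: "0 < t n" "t n \<le> 1" using t[of n] tmin by auto
    have "e (x n + t n *\<^sub>R (u n - x n)) \<le> (1 - t n) * e (x n) + t n * e (u n) + M * (norm (u n - x n))\<^sup>2"
      using fin[of "Suc n"] unfolding step
      by (rule objective_on_segment[OF fin subdiff_finite(1)[OF w] _ tn])
    then have "e (x (Suc n)) \<le> (1 - t n) * e (x n) + t n * e (u n) + M * (d n)\<^sup>2"
      by (simp only: step d_def)
    then have 1: "t n * (e (x n) - e (u n)) \<le> (r n - r (Suc n)) + M * (d n)\<^sup>2"
      by (simp add: r_def algebra_simps)
    have "(d n)\<^sup>2 \<le> (r n - r (Suc n)) / c"
      using r_dec[of n] c by (simp add: pos_le_divide_eq mult.commute)
    then have "M * (d n)\<^sup>2 \<le> M * ((r n - r (Suc n)) / c)"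
      using M_nonneg by (rule mult_left_mono)
    with 1 have 2: "t n * (e (x n) - e (u n)) \<le> (1 + M / c) * (r n - r (Suc n))"
      by (simp add: distrib_right)
    have gap: "0 \<le> (1 + M / c) * (r n - r (Suc n))"
      using M_nonneg c mono[of n] by (simp add: r_def)
    have "e (x n) - e (u n) \<le> (1 + M / c) * (r n - r (Suc n)) / t n"
      using 2 tn(1) by (simp add: pos_le_divide_eq mult.commute)
    also have "\<dots> \<le> (1 + M / c) * (r n - r (Suc n)) / tmin"
      by (rule divide_left_mono[OF t(1) gap]) (use tmin tn in simp)
    also have "\<dots> = C * (r n - r (Suc n))" by (simp add: C_def)
    finally show ?thesis by (simp add: r_def)
  qed
  have upper: "e (u n) - Es \<le> r n + norm (w n) * d n + M * (d n)\<^sup>2" for n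
  proof -
    have "e (u n) + inner (w n) (x n - u n) - M * (norm (x n - u n))\<^sup>2 \<le> e (x n)"
      by (rule subdiff_model_below[OF w fin])
    moreover have "inner (w n) (u n - x n) \<le> norm (w n) * d n"
      unfolding d_def by (rule norm_cauchy_schwarz)
    ultimately show ?thesis
      by (simp add: r_def d_def norm_minus_commute inner_diff_right)
  qed
  have "(\<lambda>n. e (u n) - Es) \<longlonglongrightarrow> 0"
  proof (rule tendsto_sandwich)
    have "(\<lambda>n. r n - C * (r n - r (Suc n))) \<longlonglongrightarrow> 0 - C * 0"
      by (intro tendsto_diff tendsto_mult tendsto_const r0 gap0)
    then show "(\<lambda>n. r n - C * (r n - r (Suc n))) \<longlonglongrightarrow> 0" by simp
    have "(\<lambda>n. r n + norm (w n) * d n + M * (d n)\<^sup>2) \<longlonglongrightarrow> 0 + 0 * 0 + M * 0\<^sup>2"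
      by (intro tendsto_intros r0 d0 tendsto_norm_zero[OF w0])
    then show "(\<lambda>n. r n + norm (w n) * d n + M * (d n)\<^sup>2) \<longlonglongrightarrow> 0" by simp
  qed (use lower upper in auto)
  then have Eu: "(\<lambda>n. e (u n)) \<longlonglongrightarrow> Es" by (simp add: LIM_zero_iff)

  obtain b where b: "0 < b"
    and "\<forall>\<^sub>F n in sequentially. Es < e (u n) \<longrightarrow> b * (e (u n) - Es) powr \<theta> \<le> norm (w n)"
    using KL_along_sequence[OF KL w u_bdd w0 Eu] by blast
  then obtain N where N: "\<And>n. N \<le> n \<Longrightarrow> Es < e (u n) \<Longrightarrow> b * (e (u n) - Es) powr \<theta> \<le> norm (w n)"
    by (auto simp: eventually_sequentially)
  define K' where "K' = 2 powr \<theta> * K / b"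
  have alt: "r (Suc n) \<le> 2 * C * (r (Suc n) - r (Suc (Suc n))) \<or>
      r (Suc n) powr \<theta> \<le> K' * (d (Suc n) + d n)" if "N \<le> n" for n
  proof (subst disj_imp, rule impI)
    \<comment> \<open>Unless the gap contracts linearly, \<open>u (Suc n)\<close> lies above the level \<open>Es\<close> by at least half the
      gap, so the KL inequality applies there.\<close>
    assume large: "\<not> r (Suc n) \<le> 2 * C * (r (Suc n) - r (Suc (Suc n)))"
    have "0 \<le> 2 * C * (r (Suc n) - r (Suc (Suc n)))"
      using C mono[of "Suc n"] by (simp add: r_def)
    with large have r_pos: "0 < r (Suc n)" by linarith
    from large have half: "r (Suc n) / 2 \<le> e (u (Suc n)) - Es"
      using lower[of "Suc n"] by simp
    then have "b * (e (u (Suc n)) - Es) powr \<theta> \<le> norm (w (Suc n))"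
      using r_pos that by (intro N) auto
    also have "\<dots> \<le> K * (d (Suc n) + d n)"
      using wK by (simp add: d_def)
    finally have 1: "b * (e (u (Suc n)) - Es) powr \<theta> \<le> K * (d (Suc n) + d n)" .
    have "(r (Suc n) / 2) powr \<theta> \<le> (e (u (Suc n)) - Es) powr \<theta>"
      using half r_pos \<theta> by (intro powr_mono2) auto
    then have "b * (r (Suc n) / 2) powr \<theta> \<le> b * (e (u (Suc n)) - Es) powr \<theta>"
      using b by simp
    with 1 have "b * (r (Suc n) / 2) powr \<theta> \<le> K * (d (Suc n) + d n)" by linarith
    then have "b * r (Suc n) powr \<theta> / 2 powr \<theta> \<le> K * (d (Suc n) + d n)"
      using r_pos by (simp add: powr_divide)
    then have "b * r (Suc n) powr \<theta> \<le> 2 powr \<theta> * (K * (d (Suc n) + d n))"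
      by (simp add: pos_divide_le_eq mult.commute)
    then have "r (Suc n) powr \<theta> \<le> 2 powr \<theta> * (K * (d (Suc n) + d n)) / b"
      using b by (simp add: pos_le_divide_eq mult.commute)
    then show "r (Suc n) powr \<theta> \<le> K' * (d (Suc n) + d n)"
      by (simp add: K'_def mult.assoc)
  qed
  have "summable (\<lambda>n. d (n + N))"
  proof (rule finite_length_of_alternative[where r = "\<lambda>n. r (n + N)" and c = c and C = "2 * C"
        and K = K' and \<theta> = \<theta>])
    show "0 \<le> r (n + N)" for n by (rule r_nonneg)
    show "0 \<le> d (n + N)" for n by (rule d_nonneg)
    show "0 < K'" using K b by (simp add: K'_def)
    show "0 < 2 * C" using C by simp
    show "c * (d (n + N))\<^sup>2 \<le> r (n + N) - r (Suc n + N)" for n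
      using r_dec[of "n + N"] by (simp only: add_Suc)
    show "r (Suc n + N) \<le> 2 * C * (r (Suc n + N) - r (Suc (Suc n) + N)) \<or>
        r (Suc n + N) powr \<theta> \<le> K' * (d (Suc n + N) + d (n + N))" for n
      using alt[OF le_add2[of N n]] by (simp only: add_Suc)
  qed (rule c \<theta>)+
  then have "summable d" by (simp only: summable_iff_shift)
  moreover have "norm (norm (x (Suc n) - x n)) \<le> d n" if "0 \<le> n" for n
  proof -
    have "norm (x (Suc n) - x n) = t n * d n"
      using t(1)[of n] tmin by (simp add: step d_def)
    also have "\<dots> \<le> 1 * d n" using t(2)[of n] d_nonneg[of n] by (intro mult_right_mono) auto
    finally show ?thesis by simp
  qed
  ultimately have sum: "summable (\<lambda>n. norm (x (Suc n) - x n))"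
    by (rule summable_comparison_test')
  then have "summable (\<lambda>n. x (Suc n) - x n)" by (rule summable_norm_cancel)
  then have "convergent (\<lambda>n. \<Sum>i<n. x (Suc i) - x i)" by (simp only: summable_iff_convergent)
  then have "convergent (\<lambda>n. x n - x 0)" by (simp only: sum_lessThan_telescope)
  then obtain l where "(\<lambda>n. x n - x 0) \<longlonglongrightarrow> l"
    by (auto simp only: convergent_def)
  from tendsto_add[OF this tendsto_const[of "x 0"]] have xl: "x \<longlonglongrightarrow> l + x 0"
    by simp
  have "u \<longlonglongrightarrow> (l + x 0) + 0"
    using tendsto_add[OF xl ux0] by simp
  then have "u \<longlonglongrightarrow> l + x 0" by simp
  then have "critical_point f g1 g2 (l + x 0)"
    by (rule subdiff_closed(1)[OF w _ w0 Eu])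
  with xl sum show ?thesis by blast
qed

section \<open>The iteration\<close>

text \<open>The optimality condition of the subproblem, with \<open>\<xi>\<close> forced to be the gradient of \<open>g2\<close> at \<open>x\<close>.\<close>

lemma pass_subgradient:
  assumes \<xi>: "\<xi> \<in> subdifferential (\<lambda>z. ereal (g2 z)) x"
    and pass: "dca_pass f g1 g2 \<rho> \<omega> \<eta> n x \<xi> \<alpha> y u k"
  shows "grad g2 x - grad g2 u - (1 / \<alpha>) *\<^sub>R (u - y) \<in> dE u"
proof -
  define s where "s = (\<lambda>z. inner (- \<xi>) (z - y) + 1 / (2 * \<alpha>) * (norm (z - y))\<^sup>2 + f z)"
  have sub: "subproblem f g1 \<xi> \<alpha> y z = ereal (s z) + g1 z" for z
    by (simp add: subproblem_def s_def)
  have min: "ereal (s u) + g1 u \<le> ereal (s z) + g1 z" for z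
    using pass unfolding dca_pass_def is_arg_min_def sub by (meson not_le)
  obtain z0 where z0: "g1 z0 \<noteq> \<infinity>" using g1_proper by (auto simp: proper_fun_def)
  have fin: "\<bar>g1 u\<bar> \<noteq> \<infinity>"
    using min[of z0] z0 g1_not_MInf[of u] by (cases "g1 z0") auto
  define p where "p = - \<xi> + (1 / \<alpha>) *\<^sub>R (u - y) + grad f u"
  have "((\<lambda>z. inner (- \<xi>) (z - y) + c * inner (z - y) (z - y) + f z)
      has_derivative (\<lambda>h. inner h (- \<xi> + (2 * c) *\<^sub>R (u - y) + grad f u))) (at u)" for c
    using f_gderiv[of u] unfolding gderiv_def
    by (auto intro!: derivative_eq_intros
        simp: inner_add_right inner_diff_right inner_diff_left inner_commute fun_eq_iff algebra_simps)
  from this[of "1 / (2 * \<alpha>)"]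
  have "((\<lambda>z. inner (- \<xi>) (z - y) + 1 / (2 * \<alpha>) * inner (z - y) (z - y) + f z)
      has_derivative (\<lambda>h. inner h p)) (at u)"
    by (simp add: p_def)
  then have "GDERIV s u :> p"
    unfolding gderiv_def s_def power2_norm_eq_inner .
  then have "- p \<in> subdifferential g1 u"
    by (rule subgradient_at_minimizer[OF _ g1_convex g1_not_MInf fin min])
  moreover have "\<xi> = grad g2 x"
    by (rule subdifferential_differentiable[OF g2_gderiv \<xi>])
  then have "grad g2 x - grad g2 u - (1 / \<alpha>) *\<^sub>R (u - y) = grad f u + (- p) - grad g2 u"
    by (simp add: p_def)
  ultimately show ?thesis
    unfolding objective_subdiff_def by blast
qed

text \<open>The starting point may lie outside the domain of \<open>g1\<close>. Then the line search accepts at once, and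
  the next iterate is the subproblem solution, where \<open>g1\<close> is finite.\<close>

lemma pass_finite:
  assumes \<xi>: "\<xi> \<in> subdifferential (\<lambda>z. ereal (g2 z)) x"
    and pass: "dca_pass f g1 g2 \<rho> \<omega> \<eta> n x \<xi> \<alpha> y u k"
  shows "\<bar>E (x + \<rho> ^ k *\<^sub>R (u - x))\<bar> \<noteq> \<infinity>"
proof (cases "\<bar>E x\<bar> = \<infinity>")
  case True
  then have "E x = \<infinity>" using objective_not_MInf[of x] by auto
  then have "armijo E \<eta> x (u - x) (\<omega> / (real n + 1) * (norm (u - x))\<^sup>2) (\<rho> ^ 0)"
    by (simp add: armijo_def)
  then have "k = 0"
    using pass unfolding dca_pass_def Let_def by blast
  then show ?thesis using subdiff_finite(1)[OF pass_subgradient[OF \<xi> pass]] by simp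
next
  case False
  then obtain b where b: "E x = ereal b" by auto
  have "armijo E \<eta> x (u - x) (\<omega> / (real n + 1) * (norm (u - x))\<^sup>2) (\<rho> ^ k)"
    using pass unfolding dca_pass_def Let_def by blast
  then show ?thesis
    using objective_not_MInf[of "x + \<rho> ^ k *\<^sub>R (u - x)"] unfolding armijo_def b
    by (cases "E (x + \<rho> ^ k *\<^sub>R (u - x))") auto
qed

text \<open>Without extrapolation, adding the subgradient inequalities of \<open>f\<close> and \<open>g1\<close> at \<open>u\<close> and of \<open>g2\<close> at \<open>x\<close>
  cancels all gradients and leaves the decrease \<open>(norm (u - x))\<^sup>2 / \<alpha>\<close>.\<close>

lemma unextrapolated_pass_full_step:
  assumes \<xi>: "\<xi> \<in> subdifferential (\<lambda>z. ereal (g2 z)) x"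
    and pass: "dca_pass f g1 g2 \<rho> \<omega> \<eta> n x \<xi> \<alpha> x u k"
    and fin: "\<bar>E x\<bar> \<noteq> \<infinity>" and \<eta>: "\<eta> \<le> 1 / \<alpha>" and \<omega>: "0 \<le> \<omega>"
  shows "k = 0"
proof -
  let ?w = "grad g2 x - grad g2 u - (1 / \<alpha>) *\<^sub>R (u - x)"
  have "?w \<in> dE u" by (rule pass_subgradient[OF \<xi> pass])
  then obtain v where v: "v \<in> subdifferential g1 u" "?w = grad f u + v - grad g2 u"
    by (auto simp: objective_subdiff_def)
  then have v_eq: "v = grad g2 x - (1 / \<alpha>) *\<^sub>R (u - x) - grad f u"
  proof -
    have "v = (grad f u + v - grad g2 u) - grad f u + grad g2 u" by simp
    also have "\<dots> = ?w - grad f u + grad g2 u" by (simp only: v(2))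
    finally show ?thesis by simp
  qed
  obtain a b where ab: "g1 u = ereal a" "g1 x = ereal b"
    using v(1) fin by (auto simp: objective_finite_iff subdifferential_def)
  have "g1 u + ereal (inner v (x - u)) \<le> g1 x"
    using v(1) unfolding subdifferential_def by blast
  then have 1: "a + inner v (x - u) \<le> b" by (simp add: ab)
  have 2: "f u + inner (grad f u) (x - u) \<le> f x"
    by (rule convex_gradient_below[OF f_convex f_gderiv])
  have 3: "g2 x + inner (grad g2 x) (u - x) \<le> g2 u"
    by (rule convex_gradient_below[OF g2_convex g2_gderiv])
  have 4: "inner v (x - u) = - inner (grad g2 x) (u - x) + 1 / \<alpha> * (norm (u - x))\<^sup>2 - inner (grad f u) (x - u)"
    unfolding v_eq power2_norm_eq_inner
    by (simp add: inner_diff_left inner_diff_right algebra_simps)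
  have "\<eta> * (norm (u - x))\<^sup>2 \<le> 1 / \<alpha> * (norm (u - x))\<^sup>2"
    using \<eta> by (rule mult_right_mono) simp
  then have "f u + a - g2 u \<le> f x + b - g2 x - \<eta> * (norm (u - x))\<^sup>2"
    using 1 2 3 4 by linarith
  moreover have "0 \<le> \<omega> / (real n + 1) * (norm (u - x))\<^sup>2" using \<omega> by simp
  ultimately have "armijo E \<eta> x (u - x) (\<omega> / (real n + 1) * (norm (u - x))\<^sup>2) (\<rho> ^ 0)"
    by (simp add: armijo_def objective_real[OF ab(1)] objective_real[OF ab(2)])
  then show ?thesis
    using pass unfolding dca_pass_def Let_def by blast
qed

lemma iteration_finite:
  assumes "pABBDCA_iter f g1 g2 \<rho> \<beta>bar \<omega> \<eta> Nmax n xp x \<xi> \<alpha> y x'"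
  shows "\<bar>E x'\<bar> \<noteq> \<infinity>"
  using assms pass_finite unfolding pABBDCA_iter_def Let_def
  by (metis (no_types, lifting))

text \<open>What \<open>descent_convergence\<close> needs from one iteration. For \<open>n \<ge> 2\<close> the extrapolation parameter is
  positive, so that a line search with more than \<open>Nmax\<close> backtracks is restarted.\<close>

lemma iteration_step:
  assumes iter: "pABBDCA_iter f g1 g2 \<rho> \<beta>bar \<omega> \<eta> Nmax n xp x \<xi> \<alpha> y x'"
    and fin: "\<bar>E x\<bar> \<noteq> \<infinity>" and n: "2 \<le> n"
    and \<alpha>: "0 < \<alpha>min" "\<alpha>min \<le> \<alpha>" "\<eta> \<le> 1 / \<alpha>"
    and \<rho>: "0 < \<rho>" "\<rho> < 1" and \<beta>: "0 < \<beta>bar" "\<beta>bar < 1" and \<omega>: "0 \<le> \<omega>"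
    and small: "\<omega> / (real n + 1) \<le> \<eta> * \<rho> ^ Nmax / 2" and \<eta>: "0 < \<eta>"
  shows "\<exists>u w t. w \<in> dE u \<and>
    norm w \<le> (M + 1 / \<alpha>min) * (norm (u - x) + norm (x - xp)) \<and>
    \<rho> ^ Nmax \<le> t \<and> t \<le> 1 \<and> x' = x + t *\<^sub>R (u - x) \<and>
    e x' \<le> e x - \<eta> * \<rho> ^ Nmax / 2 * (norm (u - x))\<^sup>2"
proof -
  define \<beta> where "\<beta> = min ((real n - 1) / (real n + 2)) \<beta>bar"
  have b: "0 < \<beta>" "\<beta> \<le> 1" using n \<beta> by (auto simp: \<beta>_def)
  have \<xi>: "\<xi> \<in> subdifferential (\<lambda>z. ereal (g2 z)) x"
    using iter by (simp add: pABBDCA_iter_def)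
  obtain u0 k0 where u0: "dca_pass f g1 g2 \<rho> \<omega> \<eta> n x \<xi> \<alpha> (x + \<beta> *\<^sub>R (x - xp)) u0 k0" "u0 \<noteq> x"
    and br: "if k0 > Nmax \<and> \<beta> > 0
            then y = x \<and>
                 (\<exists>u' k'. dca_pass f g1 g2 \<rho> \<omega> \<eta> n x \<xi> \<alpha> x u' k' \<and> x' = x + \<rho> ^ k' *\<^sub>R (u' - x))
            else y = x + \<beta> *\<^sub>R (x - xp) \<and> x' = x + \<rho> ^ k0 *\<^sub>R (u0 - x)"
    using iter unfolding pABBDCA_iter_def Let_def \<beta>_def by blast
  \<comment> \<open>Both branches are a pass with at most \<open>Nmax\<close> backtracks, with extrapolation parameter \<open>\<gamma> = 0\<close>
    after a restart and \<open>\<gamma> = \<beta>\<close> otherwise.\<close>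
  have "\<exists>y u k \<gamma>. 0 \<le> \<gamma> \<and> \<gamma> \<le> 1 \<and> y = x + \<gamma> *\<^sub>R (x - xp) \<and> k \<le> Nmax \<and>
      dca_pass f g1 g2 \<rho> \<omega> \<eta> n x \<xi> \<alpha> y u k \<and> x' = x + \<rho> ^ k *\<^sub>R (u - x)"
  proof (cases "k0 > Nmax")
    case True
    then obtain u' k' where p: "dca_pass f g1 g2 \<rho> \<omega> \<eta> n x \<xi> \<alpha> x u' k'" "x' = x + \<rho> ^ k' *\<^sub>R (u' - x)"
      using br b by auto
    have "k' = 0" by (rule unextrapolated_pass_full_step[OF \<xi> p(1) fin \<alpha>(3) \<omega>])
    with p show ?thesis
      by (intro exI[of _ x] exI[of _ u'] exI[of _ k'] exI[of _ 0]) simp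
  next
    case False
    with br u0 b show ?thesis
      by (intro exI[of _ "x + \<beta> *\<^sub>R (x - xp)"] exI[of _ u0] exI[of _ k0] exI[of _ \<beta>]) simp
  qed
  then obtain y u k \<gamma> where \<gamma>: "0 \<le> \<gamma>" "\<gamma> \<le> 1" "y = x + \<gamma> *\<^sub>R (x - xp)" and k: "k \<le> Nmax"
    and pass: "dca_pass f g1 g2 \<rho> \<omega> \<eta> n x \<xi> \<alpha> y u k" and x': "x' = x + \<rho> ^ k *\<^sub>R (u - x)"
    by blast
  define w where "w = grad g2 x - grad g2 u - (1 / \<alpha>) *\<^sub>R (u - y)"
  have w: "w \<in> dE u"
    unfolding w_def by (rule pass_subgradient[OF \<xi> pass])
  have "norm (u - y) = norm ((u - x) - \<gamma> *\<^sub>R (x - xp))"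
    by (simp add: \<gamma>(3) algebra_simps)
  also have "\<dots> \<le> norm (u - x) + norm (\<gamma> *\<^sub>R (x - xp))"
    by (rule norm_triangle_ineq4)
  also have "norm (\<gamma> *\<^sub>R (x - xp)) \<le> norm (x - xp)"
    using \<gamma> by (simp add: mult_left_le_one_le)
  finally have uy: "norm (u - y) \<le> norm (u - x) + norm (x - xp)" by simp
  have "norm w \<le> norm (grad g2 x - grad g2 u) + norm ((1 / \<alpha>) *\<^sub>R (u - y))"
    unfolding w_def by (rule norm_triangle_ineq4)
  also have "norm (grad g2 x - grad g2 u) \<le> M * norm (u - x)"
    using lipschitz_onD[OF g2_lipschitz, of x u] by (simp add: dist_norm norm_minus_commute)
  also have "M * norm (u - x) \<le> M * (norm (u - x) + norm (x - xp))"
    using M_nonneg by (intro mult_left_mono) auto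
  also have "norm ((1 / \<alpha>) *\<^sub>R (u - y)) = 1 / \<alpha> * norm (u - y)"
    using \<alpha> by simp
  also have "\<dots> \<le> 1 / \<alpha>min * (norm (u - x) + norm (x - xp))"
    using \<alpha> uy by (intro mult_mono frac_le) auto
  finally have wn: "norm w \<le> (M + 1 / \<alpha>min) * (norm (u - x) + norm (x - xp))"
    by (simp add: distrib_right)
  have \<rho>k: "\<rho> ^ Nmax \<le> \<rho> ^ k" "\<rho> ^ k \<le> 1"
    using k \<rho> by (auto intro: power_decreasing power_le_one)
  let ?D = "(norm (u - x))\<^sup>2"
  have "armijo E \<eta> x (u - x) (\<omega> / (real n + 1) * ?D) (\<rho> ^ k)"
    using pass unfolding dca_pass_def Let_def by blast
  then have "E x' \<le> E x - ereal (\<eta> * \<rho> ^ k * ?D) + ereal (\<omega> / (real n + 1) * ?D)"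
    by (simp only: armijo_def x')
  moreover obtain p q where pq: "E x = ereal p" "E x' = ereal q"
    using fin iteration_finite[OF iter] by auto
  ultimately have "q \<le> p - \<eta> * \<rho> ^ k * ?D + \<omega> / (real n + 1) * ?D"
    by simp
  moreover have "\<eta> * \<rho> ^ Nmax * ?D \<le> \<eta> * \<rho> ^ k * ?D"
    using \<eta> \<rho>k by (intro mult_right_mono mult_left_mono) auto
  moreover have "\<omega> / (real n + 1) * ?D \<le> \<eta> * \<rho> ^ Nmax / 2 * ?D"
    using small by (rule mult_right_mono) simp
  moreover have "\<eta> * \<rho> ^ Nmax / 2 * ?D = (\<eta> * \<rho> ^ Nmax * ?D) / 2" by simp
  ultimately have "q \<le> p - \<eta> * \<rho> ^ Nmax / 2 * ?D" by linarith
  then have "e x' \<le> e x - \<eta> * \<rho> ^ Nmax / 2 * ?D"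
    by (simp only: pq real_of_ereal.simps)
  with w wn \<rho>k x' show ?thesis by blast
qed

end

lemma bb_step_bounds:
  assumes "\<alpha>min \<le> \<alpha>max"
  shows "\<alpha>min \<le> bb_step f \<alpha>min \<alpha>max n y x'" "bb_step f \<alpha>min \<alpha>max n y x' \<le> \<alpha>max"
  using assms by (auto simp: bb_step_def Let_def)

theorem theorem5:
  fixes f g2 :: "'a::euclidean_space \<Rightarrow> real" and g1 :: "'a \<Rightarrow> ereal"
    and L L_g2 \<alpha>0 \<alpha>min \<alpha>max \<rho> \<beta>bar \<omega> \<eta> \<theta> :: real and Nmax :: nat
    and x :: "nat \<Rightarrow> 'a"
  assumes f_convex: "convex_on UNIV f"
    and f_diff: "f differentiable_on UNIV"
    and f_C1: "continuous_on UNIV (grad f)"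
    and f_lipschitz: "L-lipschitz_on UNIV (grad f)"
    and g1_proper: "proper_fun g1"
    and g1_lsc: "lsc_fun g1"
    and g1_convex: "convex_ereal_fun g1"
    and g2_convex: "convex_on UNIV g2"
    and g2_diff: "g2 differentiable_on UNIV"
    and g2_C1: "continuous_on UNIV (grad g2)"
    and g2_lipschitz: "L_g2-lipschitz_on UNIV (grad g2)"
    and bounded_below: "\<exists>m::real. \<forall>z. ereal m \<le> objective f g1 g2 z"
    and level_compact: "\<forall>a::real. compact {z. objective f g1 g2 z \<le> ereal a}"
    and "0 < \<alpha>0" and "0 < \<alpha>min" and "\<alpha>min < \<alpha>max"
    and "0 < \<rho>" and "\<rho> < 1"
    and "0 < \<beta>bar" and "\<beta>bar < 1"
    and "0 < \<omega>" and "\<omega> < 1"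
    and "0 < \<eta>" and "\<eta> < 1 / \<alpha>max"
    and "1 \<le> Nmax"
    and generated: "pABBDCA_er f g1 g2 \<alpha>0 \<alpha>min \<alpha>max \<rho> \<beta>bar \<omega> \<eta> Nmax x"
    and x_bounded: "bounded (range x)"
    and "0 \<le> \<theta>" and "\<theta> < 1"
    and KL: "KL_exponent f g1 g2 \<theta>"
  shows "(\<exists>xs. critical_point f g1 g2 xs \<and> x \<longlonglongrightarrow> xs) \<and>
         summable (\<lambda>n. norm (x (Suc n) - x n))"
proof -
  interpret dc_composite f g2 g1 L_g2
    using assms by unfold_locales
      (auto intro!: differentiable_GDERIV_grad simp: differentiable_on_def)
  obtain \<xi> \<alpha> y where
    iter: "\<And>n. pABBDCA_iter f g1 g2 \<rho> \<beta>bar \<omega> \<eta> Nmax n (x (n - 1)) (x n) (\<xi> n) (\<alpha> n) (y n) (x (Suc n))"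
    and \<alpha>: "\<And>n. \<alpha> (Suc n) = bb_step f \<alpha>min \<alpha>max n (y n) (x (Suc n))"
    using generated unfolding pABBDCA_er_def by blast
  obtain m where m: "\<And>z. ereal m \<le> objective f g1 g2 z"
    using bounded_below by blast
  have fin: "\<bar>objective f g1 g2 (x (Suc n))\<bar> \<noteq> \<infinity>" for n
    by (rule iteration_finite[OF iter])
  define \<sigma> where "\<sigma> = \<eta> * \<rho> ^ Nmax / 2"
  have \<sigma>: "0 < \<sigma>" using assms by (simp add: \<sigma>_def)
  obtain k where k: "\<omega> / \<sigma> < real k" using reals_Archimedean2 by blast
  \<comment> \<open>From \<open>N\<close> on, the relaxation term uses at most half of the decrease; \<open>N \<ge> 2\<close> also skips \<open>\<alpha>0\<close>,
    which may exceed \<open>\<alpha>max\<close>, and an infinite initial energy.\<close>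
  define N where "N = k + 2"
  have small: "\<omega> / (real (n + N) + 1) \<le> \<eta> * \<rho> ^ Nmax / 2" for n
  proof -
    have "\<omega> / \<sigma> \<le> real (n + N) + 1" using k by (simp add: N_def)
    then have "\<omega> \<le> \<sigma> * (real (n + N) + 1)"
      using \<sigma> by (simp add: pos_divide_le_eq mult.commute)
    then have "\<omega> / (real (n + N) + 1) \<le> \<sigma>"
      by (subst pos_divide_le_eq) auto
    then show ?thesis by (simp add: \<sigma>_def)
  qed
  define X where "X = (\<lambda>n. x (n + N))"
  have X_fin: "\<bar>objective f g1 g2 (X n)\<bar> \<noteq> \<infinity>" for n
    using fin[of "n + N - 1"] by (simp add: X_def N_def)
  have "\<exists>u w t. w \<in> objective_subdiff f g1 g2 u \<and>
      norm w \<le> (L_g2 + 1 / \<alpha>min) * (norm (u - X n) + norm (X n - x (n + N - 1))) \<and>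
      \<rho> ^ Nmax \<le> t \<and> t \<le> 1 \<and> X (Suc n) = X n + t *\<^sub>R (u - X n) \<and>
      e (X (Suc n)) \<le> e (X n) - \<sigma> * (norm (u - X n))\<^sup>2" for n
  proof -
    have \<alpha>n: "\<alpha>min \<le> \<alpha> (n + N)" "\<alpha> (n + N) \<le> \<alpha>max"
      using bb_step_bounds[of \<alpha>min \<alpha>max f] \<open>\<alpha>min < \<alpha>max\<close> \<alpha>[of "n + N - 1"]
      by (simp_all add: N_def)
    then have "1 / \<alpha>max \<le> 1 / \<alpha> (n + N)"
      using \<open>0 < \<alpha>min\<close> by (intro divide_left_mono) auto
    then have \<eta>n: "\<eta> \<le> 1 / \<alpha> (n + N)"
      using \<open>\<eta> < 1 / \<alpha>max\<close> by linarith
    have "2 \<le> n + N" by (simp add: N_def)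
    show ?thesis
      using iteration_step[OF iter X_fin[unfolded X_def] \<open>2 \<le> n + N\<close> \<open>0 < \<alpha>min\<close> \<alpha>n(1) \<eta>n
          \<open>0 < \<rho>\<close> \<open>\<rho> < 1\<close> \<open>0 < \<beta>bar\<close> \<open>\<beta>bar < 1\<close> less_imp_le[OF \<open>0 < \<omega>\<close>] small \<open>0 < \<eta>\<close>]
      by (simp add: X_def \<sigma>_def)
  qed
  then obtain u w t where
    w: "\<And>n. w n \<in> objective_subdiff f g1 g2 (u n)"
    and wn: "\<And>n. norm (w n) \<le> (L_g2 + 1 / \<alpha>min) * (norm (u n - X n) + norm (X n - x (n + N - 1)))"
    and t: "\<And>n. \<rho> ^ Nmax \<le> t n" "\<And>n. t n \<le> 1"
    and step: "\<And>n. X (Suc n) = X n + t n *\<^sub>R (u n - X n)"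
    and dec: "\<And>n. e (X (Suc n)) \<le> e (X n) - \<sigma> * (norm (u n - X n))\<^sup>2"
    by metis
  have \<rho>N: "0 < \<rho> ^ Nmax" using \<open>0 < \<rho>\<close> by simp
  have K: "0 < L_g2 + 1 / \<alpha>min" using M_nonneg \<open>0 < \<alpha>min\<close> by (simp add: add_nonneg_pos)
  have wK: "norm (w (Suc n)) \<le>
      (L_g2 + 1 / \<alpha>min) * (norm (u (Suc n) - X (Suc n)) + norm (u n - X n))" for n
  proof -
    have "0 \<le> t n" using t(1)[of n] \<rho>N by linarith
    then have "norm (X (Suc n) - X n) \<le> norm (u n - X n)"
      using t(2)[of n] by (simp add: step mult_left_le_one_le)
    moreover have "x (Suc n + N - 1) = X n" by (simp add: X_def)
    ultimately have "norm (u (Suc n) - X (Suc n)) + norm (X (Suc n) - x (Suc n + N - 1))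
        \<le> norm (u (Suc n) - X (Suc n)) + norm (u n - X n)"
      by (simp only: add_left_mono)
    then show ?thesis
      using K by (intro order_trans[OF wn] mult_left_mono) auto
  qed
  have X_bdd: "bounded (range X)"
    using x_bounded by (rule bounded_subset) (auto simp: X_def)
  have "(\<exists>xs. critical_point f g1 g2 xs \<and> X \<longlonglongrightarrow> xs) \<and> summable (\<lambda>n. norm (X (Suc n) - X n))"
    by (rule descent_convergence[OF KL \<open>0 \<le> \<theta>\<close> \<open>\<theta> < 1\<close> m X_bdd X_fin step t \<rho>N w wK K \<sigma> dec])
  moreover have "(X \<longlonglongrightarrow> xs) = (x \<longlonglongrightarrow> xs)" for xs
    unfolding X_def by (auto intro: LIMSEQ_ignore_initial_segment dest: LIMSEQ_offset)
  moreover have "summable (\<lambda>n. norm (X (Suc n) - X n)) = summable (\<lambda>n. norm (x (Suc n) - x n))"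
    using summable_iff_shift[of "\<lambda>n. norm (x (Suc n) - x n)" N] by (simp add: X_def)
  ultimately show ?thesis by simp
qed

end
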